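(* Let $n, K, L$ be positive integers, let $N = 2n-1$, and assume $K < n$. Let $S_{\mathrm{HT}}^C, S_{\mathrm{MF}}^C\subseteq\mathbb{C}^{N\times L}$ be, respectively, the set defined by rank-constrained positive semidefinite Hankel-Toeplitz matrices sharing a common Toeplitz part and the set defined by the corresponding Hankel-Toeplitz matrix factorization (both defined in the context). Then $S_{\mathrm{MF}}^C = S_{\mathrm{HT}}^C$.
   Context: Notation: $N = 2n-1$. For a matrix $X$, $X_{:,l}$ is its $l$-th column, $\overline{X}$ its entrywise complex conjugate, $X^T$ its transpose and $X^H$ its conjugate transpose; $\overline{X}_{:,l}$ is the $l$-th column of $\overline{X}$. $\mathbb{S}_K^+$ denotes the set of (Hermitian) positive semidefinite matrices of rank at most $K$ (here of size $2n\times 2n$). Hankel operator: for $x\in\mathbb{C}^N$, $\mathcal{H}x\in\mathbb{C}^{n\times n}$ is the Hankel matrix with entries $(\mathcal{H}x)_{jk} = x_{j+k-1}$, $1\le j,k\le n$. Toeplitz operator: for $t\in\mathbb{C}^N$, $\mathcal{T}t\in\mathbb{C}^{n\times n}$ is the Toeplitz matrix with entries $(\mathcal{T}t)_{jk} = t_{n+j-k}$, $1\le j,k\le n$. The sets are: (1) $S_{\mathrm{HT}}^C$ is the set of $X\in\mathbb{C}^{N\times L}$ for which there exists $t\in\mathbb{C}^N$ such that for every $l=1,\dots,L$, $$\begin{bmatrix}\mathcal{T}\overline{t} & \mathcal{H}\overline{X}_{:,l}\\ \mathcal{H}X_{:,l} & \mathcal{T}t\end{bmatrix}\in\mathbb{S}_K^+.$$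 (2) $S_{\mathrm{MF}}^C$ is the set of $X\in\mathbb{C}^{N\times L}$ for which there exist $t\in\mathbb{C}^N$ and matrices $Z^l\in\mathbb{C}^{n\times K}$, $l=1,\dots,L$, such that for every $l=1,\dots,L$, $$\mathcal{H}X_{:,l} = Z^l (Z^l)^T,\qquad \mathcal{T}t = Z^l (Z^l)^H.$$ *)

theory Defs
  imports "Jordan_Normal_Form.DL_Rank" "Jordan_Normal_Form.Schur_Decomposition"
begin

text \<open>Vectors and matrices are indexed from 0 here: the 1-based entries \<open>x_(j+k-1)\<close> and
  \<open>t_(n+j-k)\<close> of the Hankel and Toeplitz matrices become \<open>x $ (j + k)\<close> and
  \<open>t $ (n - 1 + j - k)\<close>. The natural-number subtractions never truncate for \<open>j, k < n\<close>.\<close>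

definition hankel :: "nat \<Rightarrow> complex vec \<Rightarrow> complex mat" where
  "hankel n x = mat n n (\<lambda>(j, k). x $ (j + k))"

definition toeplitz :: "nat \<Rightarrow> complex vec \<Rightarrow> complex mat" where
  "toeplitz n t = mat n n (\<lambda>(j, k). t $ (n - 1 + j - k))"

text \<open>The order on the complex numbers is that of \<open>Complex_Order\<close>: \<open>0 \<le> z\<close> means that \<open>z\<close> is
  real and nonnegative. Since \<open>u \<bullet>c v\<close> conjugates its second argument, the form below is
  \<open>v\<^sup>H A v\<close>.\<close>

definition psd_mat :: "nat \<Rightarrow> complex mat \<Rightarrow> bool" where
  "psd_mat m A \<longleftrightarrow> A \<in> carrier_mat m m \<and> mat_adjoint A = A \<and>
     (\<forall>v \<in> carrier_vec m. 0 \<le> (A *\<^sub>v v) \<bullet>c v)"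

definition psd_rank_le :: "nat \<Rightarrow> nat \<Rightarrow> complex mat set" where
  "psd_rank_le m K = {A. psd_mat m A \<and> vec_space.rank m A \<le> K}"

definition S_HT :: "nat \<Rightarrow> nat \<Rightarrow> nat \<Rightarrow> complex mat set" where
  "S_HT n K L = {X \<in> carrier_mat (2 * n - 1) L.
     \<exists>t \<in> carrier_vec (2 * n - 1). \<forall>l < L.
       four_block_mat (toeplitz n (conjugate t)) (hankel n (conjugate (col X l)))
                      (hankel n (col X l))       (toeplitz n t)
         \<in> psd_rank_le (2 * n) K}"

definition S_MF :: "nat \<Rightarrow> nat \<Rightarrow> nat \<Rightarrow> complex mat set" where
  "S_MF n K L = {X \<in> carrier_mat (2 * n - 1) L.
     \<exists>t \<in> carrier_vec (2 * n - 1). \<exists>Z :: nat \<Rightarrow> complex mat. \<forall>l < L.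
       Z l \<in> carrier_mat n K \<and>
       hankel n (col X l) = Z l * (Z l)\<^sup>T \<and>
       toeplitz n t = Z l * mat_adjoint (Z l)}"

end

theory Submission
  imports Defs
begin

text \<open>The block matrix \<open>M\<close> is fixed by entrywise conjugation followed by the swap \<open>\<tau>\<close> of the two
  blocks of indices. If \<open>M\<close> is also positive semidefinite of rank at most \<open>K\<close>, then it can be
  factored as \<open>W W\<^sup>H\<close> with \<open>K\<close> columns that are fixed by the same symmetry, so that the upper half
  of \<open>W\<close> is the conjugate of its lower half \<open>Z\<close>; the lower blocks of \<open>M = W W\<^sup>H\<close> are then \<open>Z Z\<^sup>T\<close>
  and \<open>Z Z\<^sup>H\<close>. The columns are peeled off one by one: for a fixed vector \<open>v\<close> with
  \<open>c = v\<^sup>H M v \<noteq> 0\<close>, subtracting \<open>(M v) (M v)\<^sup>H / c\<close> preserves positivity and the symmetry and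
  removes \<open>M v\<close> from the column space.\<close>

section \<open>Rank and inclusion of column spaces\<close>

context vec_space
begin

text \<open>\<open>rank\<close> is the dimension of the span of the columns as a space of its own,
  so independence is first carried over to that subspace, where the dimension bounds independent
  sets.\<close>

lemma card_indpt_le_rank:
  assumes A: "A \<in> carrier_mat n nc" and U: "U \<subseteq> col_space A" "lin_indpt U"
  shows "card U \<le> rank A"
proof -
  let ?S = "set (cols A)"
  have S: "?S \<subseteq> carrier_vec n" using A cols_dim[of A] by auto
  interpret W: vectorspace class_ring "span_vs ?S"
    using span_is_subspace[OF S] subspace_def subspace_is_vs by blast
  have sub: "U \<subseteq> span ?S" using U(1) by (simp add: col_space_def)
  have "W.lin_indpt U"
    using span_li_not_depend(2)[OF sub span_is_submodule] S U(2) by blast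
  moreover have "W.fin_dim" by (rule fin_dim_span_cols[OF A])
  ultimately show ?thesis
    unfolding rank_def using W.li_le_dim(2)[of U] sub by simp
qed

lemma obtain_col_space_basis:
  assumes A: "A \<in> carrier_mat n nc"
  obtains U where "U \<subseteq> set (cols A)" "lin_indpt U" "card U = rank A" "finite U"
proof -
  have "lin_indpt {}" unfolding lin_dep_def by auto
  then obtain U where U: "maximal U (\<lambda>T. T \<subseteq> set (cols A) \<and> lin_indpt T)"
    using maximal_exists_superset[of "set (cols A)" "\<lambda>T. T \<subseteq> set (cols A) \<and> lin_indpt T" "{}"]
    by blast
  then have "U \<subseteq> set (cols A)" "lin_indpt U" unfolding maximal_def by auto
  with rank_card_indpt[OF A U] that show thesis by (metis finite_set finite_subset)
qed

lemma cols_subset_col_space: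
  assumes "A \<in> carrier_mat n nc"
  shows "set (cols A) \<subseteq> col_space A"
  unfolding col_space_def using assms cols_dim[of A] by (intro in_own_span) auto

lemma rank_mono_col_space:
  assumes A: "A \<in> carrier_mat n nc" and B: "B \<in> carrier_mat n nd"
    and AB: "col_space A \<subseteq> col_space B"
  shows "rank A \<le> rank B"
proof -
  obtain U where "U \<subseteq> set (cols A)" "lin_indpt U" "card U = rank A"
    using obtain_col_space_basis[OF A] by metis
  with card_indpt_le_rank[OF B, of U] cols_subset_col_space[OF A] AB show ?thesis by auto
qed

text \<open>A basis of the smaller column space stays independent after adding a vector of the
  larger space outside its span. This strictness drives the induction on the rank.\<close>

lemma rank_less_col_space:
  assumes A: "A \<in> carrier_mat n nc" and B: "B \<in> carrier_mat n nd"
    and AB: "col_space A \<subset> col_space B"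
  shows "rank A < rank B"
proof -
  obtain U where U: "U \<subseteq> set (cols A)" "lin_indpt U" "card U = rank A" "finite U"
    using obtain_col_space_basis[OF A] by metis
  obtain x where x: "x \<in> col_space B" "x \<notin> col_space A" using AB by auto
  have xc: "x \<in> carrier_vec n" using x(1) B by (auto simp: col_space_eq[OF B])
  have Uc: "U \<subseteq> carrier_vec n" using U(1) A cols_dim by blast
  have "span U \<subseteq> col_space A" unfolding col_space_def by (rule span_is_monotone[OF U(1)])
  then have "x \<notin> span U" using x(2) by blast
  moreover have "x \<notin> U" using U(1) cols_subset_col_space[OF A] x(2) by blast
  ultimately have "lin_indpt (U \<union> {x})"
    using lin_dep_iff_in_span[of U x] U(2) Uc xc by auto
  moreover have "U \<union> {x} \<subseteq> col_space B"
    using U(1) cols_subset_col_space[OF A] AB x(1) by blast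
  ultimately have "card (U \<union> {x}) \<le> rank B" by (intro card_indpt_le_rank[OF B])
  with U \<open>x \<notin> U\<close> show ?thesis by simp
qed

text \<open>Every \<open>(A * B) *\<^sub>v x\<close> is a value of \<open>A\<close>, which has only
  \<open>nc\<close> columns.\<close>

lemma rank_mult_le:
  assumes A: "A \<in> carrier_mat n nc" and B: "B \<in> carrier_mat nc nd"
  shows "rank (A * B) \<le> nc"
proof -
  have AB: "A * B \<in> carrier_mat n nd" using A B by simp
  have "col_space (A * B) \<subseteq> col_space A"
    using A B by (auto simp: col_space_eq[OF AB] col_space_eq[OF A] assoc_mult_mat_vec[OF A B]
        intro!: bexI[of _ "B *\<^sub>v _"])
  from rank_mono_col_space[OF AB A this] rank_le_nc[OF A] show ?thesis by simp
qed

end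

section \<open>Adjoints and Hermitian forms\<close>

lemma index_mat_adjoint [simp]:
  fixes A :: "complex mat"
  assumes "i < dim_col A" "j < dim_row A"
  shows "mat_adjoint A $$ (i, j) = cnj (A $$ (j, i))"
  using assms by (simp add: mat_adjoint_def mat_of_rows_index)

lemma mat_adjoint_dim [simp]:
  "dim_row (mat_adjoint A) = dim_col A" "dim_col (mat_adjoint A) = dim_row A"
  by (auto simp: mat_adjoint_def)

lemma adjoint_cscalar_prod:
  fixes A :: "complex mat"
  assumes A: "A \<in> carrier_mat m k" and u: "u \<in> carrier_vec k" and v: "v \<in> carrier_vec m"
  shows "(A *\<^sub>v u) \<bullet>c v = u \<bullet>c (mat_adjoint A *\<^sub>v v)"
proof -
  have "(A *\<^sub>v u) \<bullet>c v = (\<Sum>i<m. \<Sum>j<k. A $$ (i, j) * u $ j * cnj (v $ i))"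
    using assms by (auto simp: scalar_prod_def sum_distrib_right atLeast0LessThan intro!: sum.cong)
  also have "\<dots> = (\<Sum>j<k. \<Sum>i<m. A $$ (i, j) * u $ j * cnj (v $ i))" by (rule sum.swap)
  also have "\<dots> = u \<bullet>c (mat_adjoint A *\<^sub>v v)"
    using assms by (auto simp: scalar_prod_def sum_distrib_left atLeast0LessThan ac_simps
        intro!: sum.cong)
  finally show ?thesis .
qed

lemma cscalar_prod_commute:
  fixes u v :: "complex vec"
  assumes "u \<in> carrier_vec m" "v \<in> carrier_vec m"
  shows "u \<bullet>c v = cnj (v \<bullet>c u)"
  using assms by (auto simp: scalar_prod_def ac_simps intro!: sum.cong)

text \<open>The form at \<open>v\<close> is the squared norm of
  \<open>mat_adjoint W *\<^sub>v v\<close>.\<close>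

lemma psd_mat_mult_adjoint:
  fixes W :: "complex mat"
  assumes W: "W \<in> carrier_mat m k"
  shows "psd_mat m (W * mat_adjoint W)"
proof -
  have WH: "mat_adjoint W \<in> carrier_mat k m" using W by auto
  have "0 \<le> (W * mat_adjoint W *\<^sub>v v) \<bullet>c v" if v: "v \<in> carrier_vec m" for v
  proof -
    have "(W * mat_adjoint W *\<^sub>v v) \<bullet>c v = (mat_adjoint W *\<^sub>v v) \<bullet>c (mat_adjoint W *\<^sub>v v)"
      using adjoint_cscalar_prod[OF W _ v, of "mat_adjoint W *\<^sub>v v"] W WH v by auto
    then show ?thesis using conjugate_square_ge_0_vec by metis
  qed
  moreover have "mat_adjoint (W * mat_adjoint W) = W * mat_adjoint W"
    using W by (intro eq_matI) (auto simp: scalar_prod_def ac_simps intro!: sum.cong)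
  ultimately show ?thesis using W unfolding psd_mat_def by auto
qed

text \<open>Hermitian symmetry makes the second cross term the conjugate of the first. The expansion
  serves twice: for a suitable \<open>s\<close> it makes the form negative, or it completes the
  square.\<close>

lemma hermitian_form_add_smult:
  fixes A :: "complex mat" and s :: complex
  assumes A: "A \<in> carrier_mat m m" "mat_adjoint A = A"
    and u: "u \<in> carrier_vec m" and v: "v \<in> carrier_vec m"
  defines "b \<equiv> (A *\<^sub>v u) \<bullet>c v"
  shows "(A *\<^sub>v (u + s \<cdot>\<^sub>v v)) \<bullet>c (u + s \<cdot>\<^sub>v v) =
    (A *\<^sub>v u) \<bullet>c u + cnj s * b + s * cnj b + s * cnj s * ((A *\<^sub>v v) \<bullet>c v)"
proof -
  have vu: "(A *\<^sub>v v) \<bullet>c u = cnj b"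
    unfolding b_def using adjoint_cscalar_prod[OF A(1) v u] A u v
    by (metis cscalar_prod_commute mult_mat_vec_carrier)
  have "(A *\<^sub>v (u + s \<cdot>\<^sub>v v)) \<bullet>c (u + s \<cdot>\<^sub>v v) =
    (A *\<^sub>v u) \<bullet>c u + cnj s * ((A *\<^sub>v u) \<bullet>c v) + s * ((A *\<^sub>v v) \<bullet>c u)
      + s * cnj s * ((A *\<^sub>v v) \<bullet>c v)"
    using A u v
    by (simp add: mult_add_distrib_mat_vec[OF A(1)] mult_mat_vec[OF A(1)] conjugate_add_vec[of _ m]
       conjugate_smult_vec add_scalar_prod_distrib[of _ m] scalar_prod_add_distrib[of _ m] algebra_simps)
  then show ?thesis by (simp add: vu b_def)
qed

lemma psd_mat_form_eq_0:
  assumes psd: "psd_mat m A" and v: "v \<in> carrier_vec m" and 0: "(A *\<^sub>v v) \<bullet>c v = 0"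
  shows "A *\<^sub>v v = 0\<^sub>v m"
proof (rule ccontr)
  assume ne: "A *\<^sub>v v \<noteq> 0\<^sub>v m"
  have A: "A \<in> carrier_mat m m" "mat_adjoint A = A" using psd by (auto simp: psd_mat_def)
  define u where "u = A *\<^sub>v v"
  have u: "u \<in> carrier_vec m" using A v by (simp add: u_def)
  define b where "b = u \<bullet>c u"
  have b0: "b > 0" unfolding b_def using ne u by (simp add: u_def)
  then have cb: "cnj b = b" by (simp add: less_complex_def complex_eq_iff)
  define a where "a = (A *\<^sub>v u) \<bullet>c u"
  have a0: "a \<ge> 0" using psd u by (auto simp: psd_mat_def a_def)
  then have ca: "cnj a = a" by (simp add: less_eq_complex_def complex_eq_iff)
  have b: "(A *\<^sub>v u) \<bullet>c v = b"
    using adjoint_cscalar_prod[OF A(1) u v] A by (simp add: b_def u_def)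
  \<comment> \<open>The form is affine along \<open>v\<close>, so it becomes negative far enough from \<open>u\<close>.\<close>
  define s where "s = - (a + 1) / b"
  \<comment> \<open>Since \<open>a\<close> and \<open>b\<close> are real, so is \<open>s\<close>,
    and the form is \<open>a + 2 * s * b\<close>.\<close>
  have "(A *\<^sub>v (u + s \<cdot>\<^sub>v v)) \<bullet>c (u + s \<cdot>\<^sub>v v) = - a - 2"
    unfolding hermitian_form_add_smult[OF A u v] b 0 using b0
    by (simp add: s_def ca cb flip: a_def)
  moreover have "0 \<le> (A *\<^sub>v (u + s \<cdot>\<^sub>v v)) \<bullet>c (u + s \<cdot>\<^sub>v v)"
    using psd u v by (auto simp: psd_mat_def)
  ultimately show False using a0 by (simp add: less_eq_complex_def)
qed

section \<open>Rank-one deflation of a semidefinite matrix\<close>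

definition deflate :: "complex mat \<Rightarrow> complex vec \<Rightarrow> complex mat" where
  "deflate A v = mat (dim_row A) (dim_col A)
     (\<lambda>(i, j). A $$ (i, j) - (A *\<^sub>v v) $ i * cnj ((A *\<^sub>v v) $ j) / ((A *\<^sub>v v) \<bullet>c v))"

lemma deflate_carrier [simp]: "A \<in> carrier_mat m k \<Longrightarrow> deflate A v \<in> carrier_mat m k"
  by (auto simp: deflate_def)

lemma deflate_dim [simp]:
  "dim_row (deflate A v) = dim_row A" "dim_col (deflate A v) = dim_col A"
  by (auto simp: deflate_def)

text \<open>When the form at \<open>v\<close> is nonzero, the vector on the right is the projection
  of \<open>u\<close> along \<open>v\<close> that is orthogonal to \<open>v\<close> for the form of
  \<open>A\<close>. Deflating thus means projecting before applying \<open>A\<close>; positivity and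
  the loss of rank both follow from this.\<close>

lemma deflate_mult_vec:
  assumes A: "A \<in> carrier_mat m m" "mat_adjoint A = A"
    and v: "v \<in> carrier_vec m" and u: "u \<in> carrier_vec m"
  shows "deflate A v *\<^sub>v u =
    A *\<^sub>v (u + (- ((A *\<^sub>v u) \<bullet>c v) / ((A *\<^sub>v v) \<bullet>c v)) \<cdot>\<^sub>v v)"
proof -
  define c where "c = (A *\<^sub>v v) \<bullet>c v"
  define w where "w = A *\<^sub>v v"
  have w: "w \<in> carrier_vec m" using A v by (simp add: w_def)
  have "(A *\<^sub>v u) \<bullet>c v = u \<bullet>c w"
    using adjoint_cscalar_prod[OF A(1) u v] A by (simp add: w_def)
  then have b: "(A *\<^sub>v u) \<bullet>c v = (\<Sum>j<m. u $ j * cnj (w $ j))"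
    using u w by (simp add: scalar_prod_def atLeast0LessThan)
  have "(deflate A v *\<^sub>v u) $ i = (A *\<^sub>v u + (- ((A *\<^sub>v u) \<bullet>c v) / c) \<cdot>\<^sub>v w) $ i"
    if i: "i < m" for i
  proof -
    have "deflate A v $$ (i, j) = A $$ (i, j) - w $ i * cnj (w $ j) / c" if "j < m" for j
      using A i that by (simp add: deflate_def w_def c_def)
    then have "(deflate A v *\<^sub>v u) $ i = (\<Sum>j<m. (A $$ (i, j) - w $ i * cnj (w $ j) / c) * u $ j)"
      using A u i by (simp add: scalar_prod_def atLeast0LessThan)
    also have "\<dots> = (\<Sum>j<m. A $$ (i, j) * u $ j) - (\<Sum>j<m. u $ j * cnj (w $ j)) / c * w $ i"
      by (simp add: algebra_simps sum_subtractf sum_distrib_left sum_divide_distrib)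
    also have "\<dots> = (A *\<^sub>v u + (- ((A *\<^sub>v u) \<bullet>c v) / c) \<cdot>\<^sub>v w) $ i"
      unfolding b using A u w i by (simp add: scalar_prod_def atLeast0LessThan)
    finally show ?thesis .
  qed
  then have "deflate A v *\<^sub>v u = A *\<^sub>v u + (- ((A *\<^sub>v u) \<bullet>c v) / c) \<cdot>\<^sub>v w"
    using A u w by (intro eq_vecI) (auto simp: deflate_def)
  then show ?thesis
    using A u v by (simp add: mult_add_distrib_mat_vec[OF A(1)] mult_mat_vec[OF A(1)] c_def w_def)
qed

lemma psd_deflate:
  assumes psd: "psd_mat m A" and v: "v \<in> carrier_vec m" and c: "(A *\<^sub>v v) \<bullet>c v \<noteq> 0"
  shows "psd_mat m (deflate A v)"
proof -
  have A: "A \<in> carrier_mat m m" "mat_adjoint A = A" using psd by (auto simp: psd_mat_def)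
  let ?c = "(A *\<^sub>v v) \<bullet>c v"
  have cc: "cnj ?c = ?c" using psd v by (auto simp: psd_mat_def less_eq_complex_def complex_eq_iff)
  have "0 \<le> (deflate A v *\<^sub>v u) \<bullet>c u" if u: "u \<in> carrier_vec m" for u
  proof -
    define b where "b = (A *\<^sub>v u) \<bullet>c v"
    define s where "s = - b / ?c"
    have vu: "(A *\<^sub>v v) \<bullet>c u = cnj b"
      unfolding b_def using adjoint_cscalar_prod[OF A(1) v u] A u v
      by (metis cscalar_prod_commute mult_mat_vec_carrier)
    have "(deflate A v *\<^sub>v u) \<bullet>c u = (A *\<^sub>v u) \<bullet>c u + s * cnj b"
      unfolding deflate_mult_vec[OF A v u] s_def using A u v
      by (simp add: mult_add_distrib_mat_vec[OF A(1)] mult_mat_vec[OF A(1)]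
          add_scalar_prod_distrib[of _ m] vu flip: b_def)
    \<comment> \<open>As the form at \<open>v\<close> is real, this \<open>s\<close> makes the terms
      \<open>cnj s * b\<close> and \<open>s * cnj s * ?c\<close> cancel.\<close>
    also have "\<dots> = (A *\<^sub>v (u + s \<cdot>\<^sub>v v)) \<bullet>c (u + s \<cdot>\<^sub>v v)"
      unfolding hermitian_form_add_smult[OF A u v] using c cc by (simp add: s_def flip: b_def)
    also have "0 \<le> \<dots>" using psd u v by (auto simp: psd_mat_def)
    finally show ?thesis .
  qed
  moreover have "mat_adjoint (deflate A v) = deflate A v"
  proof (intro eq_matI)
    fix i j assume "i < dim_row (deflate A v)" "j < dim_col (deflate A v)"
    then have ij: "i < m" "j < m" using A by (auto simp: deflate_def)
    have "cnj (A $$ (j, i)) = A $$ (i, j)"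
      using ij A index_mat_adjoint[of i A j] by simp
    with ij A show "mat_adjoint (deflate A v) $$ (i, j) = deflate A v $$ (i, j)"
      by (simp add: deflate_def cc ac_simps)
  qed (use A in \<open>auto simp: deflate_def\<close>)
  ultimately show ?thesis using A unfolding psd_mat_def by simp
qed

lemma rank_deflate_less:
  assumes psd: "psd_mat m A" and v: "v \<in> carrier_vec m" and c: "(A *\<^sub>v v) \<bullet>c v \<noteq> 0"
  shows "vec_space.rank m (deflate A v) < vec_space.rank m A"
proof -
  interpret vec_space "TYPE(complex)" m .
  have A: "A \<in> carrier_mat m m" "mat_adjoint A = A" using psd by (auto simp: psd_mat_def)
  have D: "deflate A v \<in> carrier_mat m m" "mat_adjoint (deflate A v) = deflate A v"
    using psd_deflate[OF assms] by (auto simp: psd_mat_def)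
  have "col_space (deflate A v) \<subseteq> col_space A"
    using A v by (auto simp: col_space_eq[OF D(1)] col_space_eq[OF A(1)] deflate_mult_vec[OF A v])
  moreover have "A *\<^sub>v v \<in> col_space A" using A v by (auto simp: col_space_eq[OF A(1)])
  \<comment> \<open>The deflated matrix is Hermitian and kills \<open>v\<close>, so its column space
    is orthogonal to \<open>v\<close>, whereas \<open>A *\<^sub>v v\<close> is not.\<close>
  moreover have "A *\<^sub>v v \<notin> col_space (deflate A v)"
  proof
    assume "A *\<^sub>v v \<in> col_space (deflate A v)"
    then obtain x where x: "x \<in> carrier_vec m" "A *\<^sub>v v = deflate A v *\<^sub>v x"
      using A by (auto simp: col_space_eq[OF D(1)])
    have "v + (- ((A *\<^sub>v v) \<bullet>c v) / ((A *\<^sub>v v) \<bullet>c v)) \<cdot>\<^sub>v v = 0\<^sub>v m"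
      using c v by (intro eq_vecI) auto
    then have "deflate A v *\<^sub>v v = 0\<^sub>v m"
      using A unfolding deflate_mult_vec[OF A v v] by auto
    then have "(A *\<^sub>v v) \<bullet>c v = 0"
      using adjoint_cscalar_prod[OF D(1) x(1) v] x D by simp
    with c show False by simp
  qed
  ultimately show ?thesis
    using rank_less_col_space[OF D(1) A(1)] by blast
qed


section \<open>Factorization compatible with conjugation and an involution of the indices\<close>

text \<open>The fixed vectors span the whole complex space. If the form vanished on all of them,
  they would all lie in the kernel, and \<open>A\<close> would be zero.\<close>

lemma psd_conj_fixed_vec:
  fixes \<tau> :: "nat \<Rightarrow> nat"
  assumes psd: "psd_mat m A" and ne: "A \<noteq> 0\<^sub>m m m"
    and \<tau>: "\<And>i. i < m \<Longrightarrow> \<tau> i < m" "\<And>i. i < m \<Longrightarrow> \<tau> (\<tau> i) = i"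
  obtains v where "v \<in> carrier_vec m" "\<And>i. i < m \<Longrightarrow> v $ \<tau> i = cnj (v $ i)"
    "(A *\<^sub>v v) \<bullet>c v \<noteq> 0"
proof (rule ccontr)
  assume "\<not> thesis"
  with that have *: "(A *\<^sub>v v) \<bullet>c v = 0"
    if "v \<in> carrier_vec m" "\<And>i. i < m \<Longrightarrow> v $ \<tau> i = cnj (v $ i)" for v
    using that by blast
  have A: "A \<in> carrier_mat m m" using psd by (auto simp: psd_mat_def)
  have "A $$ (i, k) = 0" if i: "i < m" and k: "k < m" for i k
  proof -
    \<comment> \<open>The symmetrizations of the unit vector \<open>k\<close> and of its multiple by \<open>\<i>\<close>.\<close>
    define p where "p = vec m (\<lambda>j. (if j = k then 1 else 0) + (if j = \<tau> k then 1 else 0) :: complex)"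
    define q where "q = vec m (\<lambda>j. (if j = k then \<i> else 0) - (if j = \<tau> k then \<i> else 0))"
    \<comment> \<open>Applying \<tau> to the index swaps the two summands: this leaves
      \<open>p\<close> unchanged and negates \<open>q\<close>, in accordance with \<open>p\<close>
      being real and \<open>q\<close> imaginary.\<close>
    have sw: "\<tau> j = k \<longleftrightarrow> j = \<tau> k" "\<tau> j = \<tau> k \<longleftrightarrow> j = k" if "j < m" for j
      using \<tau> that k by metis+
    have "(A *\<^sub>v p) \<bullet>c p = 0" "(A *\<^sub>v q) \<bullet>c q = 0"
      by (rule *; simp add: p_def q_def \<tau> sw)+
    then have Apq: "A *\<^sub>v p = 0\<^sub>v m" "A *\<^sub>v q = 0\<^sub>v m"
      by (auto intro!: psd_mat_form_eq_0[OF psd] simp: p_def q_def)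
    have pq: "p \<in> carrier_vec m" "q \<in> carrier_vec m" by (auto simp: p_def q_def)
    have unit: "unit_vec m k = (1 / 2) \<cdot>\<^sub>v p + (- \<i> / 2) \<cdot>\<^sub>v q"
      using k by (intro eq_vecI) (auto simp: p_def q_def unit_vec_def)
    have "A *\<^sub>v unit_vec m k = 0\<^sub>v m"
      unfolding unit using pq
      by (auto simp: mult_add_distrib_mat_vec[OF A] mult_mat_vec[OF A] Apq intro!: eq_vecI)
    then have "(A *\<^sub>v unit_vec m k) $ i = 0" using i by simp
    then show ?thesis using A i k by simp
  qed
  then have "A = 0\<^sub>m m m" using A by (intro eq_matI) auto
  with ne show False by simp
qed

text \<open>Induction on the bound \<open>K\<close> rather than on the rank itself, so that zero
  columns may pad the factor. \<open>R\<close> is a function of two indices, which makes appending a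
  column a case distinction.\<close>

lemma psd_conj_fixed_factorization:
  fixes \<tau> :: "nat \<Rightarrow> nat"
  assumes psd: "psd_mat m A" and rank: "vec_space.rank m A \<le> K"
    and \<tau>: "\<And>i. i < m \<Longrightarrow> \<tau> i < m" "\<And>i. i < m \<Longrightarrow> \<tau> (\<tau> i) = i"
    and fixed: "\<And>i j. i < m \<Longrightarrow> j < m \<Longrightarrow> A $$ (\<tau> i, \<tau> j) = cnj (A $$ (i, j))"
  shows "\<exists>R :: nat \<Rightarrow> nat \<Rightarrow> complex.
    (\<forall>i<m. \<forall>k<K. R (\<tau> i) k = cnj (R i k)) \<and>
    (\<forall>i<m. \<forall>j<m. A $$ (i, j) = (\<Sum>k<K. R i k * cnj (R j k)))"
  using psd rank fixed
proof (induction K arbitrary: A)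
  case (0 A)
  \<comment> \<open>A nonzero matrix could be deflated to a rank below zero.\<close>
  have "A = 0\<^sub>m m m"
  proof (rule ccontr)
    assume "A \<noteq> 0\<^sub>m m m"
    then obtain v where "v \<in> carrier_vec m" "(A *\<^sub>v v) \<bullet>c v \<noteq> 0"
      using psd_conj_fixed_vec[OF "0.prems"(1) _ \<tau>] by metis
    from rank_deflate_less[OF "0.prems"(1) this] "0.prems"(2) show False by simp
  qed
  then show ?case by auto
next
  case (Suc K A)
  note psd = Suc.prems(1) and fixed = Suc.prems(3)
  have A: "A \<in> carrier_mat m m" using psd by (auto simp: psd_mat_def)
  show ?case
  proof (cases "A = 0\<^sub>m m m")
    case True
    then show ?thesis by (intro exI[of _ "\<lambda>_ _. 0"]) auto
  next
    case False
    then obtain v where v: "v \<in> carrier_vec m" "(A *\<^sub>v v) \<bullet>c v \<noteq> 0"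
      and vfix: "\<And>i. i < m \<Longrightarrow> v $ \<tau> i = cnj (v $ i)"
      using psd_conj_fixed_vec[OF psd False \<tau>] by metis
    define w where "w = A *\<^sub>v v"
    define c where "c = (A *\<^sub>v v) \<bullet>c v"
    have "c \<ge> 0" using psd v by (auto simp: psd_mat_def c_def)
    then obtain d where d: "c = complex_of_real d" "d \<ge> 0"
      by (metis less_eq_complex_def zero_complex.sel complex_is_Real_iff Reals_cases Re_complex_of_real)
    have d0: "d > 0" using d v(2) by (cases "d = 0") (auto simp flip: c_def)
    have D: "deflate A v $$ (i, j) = A $$ (i, j) - w $ i * cnj (w $ j) / c"
      if "i < m" "j < m" for i j
      using A that by (simp add: deflate_def w_def c_def)
    have bij: "bij_betw \<tau> {..<m} {..<m}"
      by (rule bij_betw_byWitness[where f' = \<tau>]) (auto simp: \<tau>)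
    \<comment> \<open>The symmetries of \<open>A\<close> and \<open>v\<close> combine once the sum
      is reindexed by \<tau>; hence the deflated matrix is symmetric too.\<close>
    have wfix: "w $ \<tau> i = cnj (w $ i)" if i: "i < m" for i
    proof -
      have "w $ \<tau> i = (\<Sum>j<m. A $$ (\<tau> i, j) * v $ j)"
        using A v i \<tau> by (simp add: w_def scalar_prod_def atLeast0LessThan)
      also have "\<dots> = (\<Sum>j<m. A $$ (\<tau> i, \<tau> j) * v $ \<tau> j)"
        by (rule sum.reindex_bij_betw[OF bij, symmetric])
      also have "\<dots> = cnj (w $ i)"
        using A v i by (simp add: w_def scalar_prod_def atLeast0LessThan fixed vfix)
      finally show ?thesis .
    qed
    have "\<exists>R :: nat \<Rightarrow> nat \<Rightarrow> complex.
      (\<forall>i<m. \<forall>k<K. R (\<tau> i) k = cnj (R i k)) \<and>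
      (\<forall>i<m. \<forall>j<m. deflate A v $$ (i, j) = (\<Sum>k<K. R i k * cnj (R j k)))"
    proof (rule Suc.IH)
      show "psd_mat m (deflate A v)" by (rule psd_deflate[OF psd v])
      show "vec_space.rank m (deflate A v) \<le> K"
        using rank_deflate_less[OF psd v] Suc.prems(2) by simp
    qed (simp add: D \<tau> fixed wfix d(1))
    then obtain R :: "nat \<Rightarrow> nat \<Rightarrow> complex" where
      R: "\<And>i k. i < m \<Longrightarrow> k < K \<Longrightarrow> R (\<tau> i) k = cnj (R i k)"
        "\<And>i j. i < m \<Longrightarrow> j < m \<Longrightarrow> deflate A v $$ (i, j) = (\<Sum>k<K. R i k * cnj (R j k))"
      by blast
    \<comment> \<open>The new column, at index \<open>K\<close>, restores the subtracted rank-one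
      term. Its scaling is real, so it keeps the symmetry of \<open>w\<close>.\<close>
    define R' where "R' i k = (if k < K then R i k else w $ i / complex_of_real (sqrt d))" for i k
    have "complex_of_real (sqrt d) * complex_of_real (sqrt d) = c"
      using d by (simp flip: of_real_mult)
    then have "A $$ (i, j) = (\<Sum>k<Suc K. R' i k * cnj (R' j k))" if "i < m" "j < m" for i j
      using D[OF that] R(2)[OF that] by (simp add: R'_def)
    moreover have "R' (\<tau> i) k = cnj (R' i k)" if "i < m" for i k
      using that by (simp add: R'_def R(1) wfix)
    ultimately show ?thesis by blast
  qed
qed

section \<open>Hankel-Toeplitz block matrices\<close>

lemma hankel_carrier [simp]: "hankel n x \<in> carrier_mat n n"
  by (simp add: hankel_def)

lemma toeplitz_carrier [simp]: "toeplitz n x \<in> carrier_mat n n"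
  by (simp add: toeplitz_def)

lemma hankel_conjugate:
  "x \<in> carrier_vec (2 * n - 1) \<Longrightarrow> i < n \<Longrightarrow> j < n \<Longrightarrow>
    hankel n (conjugate x) $$ (i, j) = cnj (hankel n x $$ (i, j))"
  by (simp add: hankel_def)

lemma toeplitz_conjugate:
  "t \<in> carrier_vec (2 * n - 1) \<Longrightarrow> i < n \<Longrightarrow> j < n \<Longrightarrow>
    toeplitz n (conjugate t) $$ (i, j) = cnj (toeplitz n t $$ (i, j))"
  by (simp add: toeplitz_def)

text \<open>The claim for a single column with \<open>t\<close> held fixed, so that the equivalence
  can be applied to each column under a common \<open>t\<close>.\<close>

lemma hankel_toeplitz_factorization_iff:
  fixes x t :: "complex vec"
  assumes x: "x \<in> carrier_vec (2 * n - 1)" and t: "t \<in> carrier_vec (2 * n - 1)"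
  shows "four_block_mat (toeplitz n (conjugate t)) (hankel n (conjugate x))
        (hankel n x) (toeplitz n t) \<in> psd_rank_le (2 * n) K \<longleftrightarrow>
      (\<exists>Z \<in> carrier_mat n K. hankel n x = Z * Z\<^sup>T \<and> toeplitz n t = Z * mat_adjoint Z)"
    (is "?M \<in> _ \<longleftrightarrow> _")
proof
  note conj = hankel_conjugate[OF x] toeplitz_conjugate[OF t]
  have dims [simp]: "dim_row (hankel n y) = n" "dim_col (hankel n y) = n"
    "dim_row (toeplitz n y) = n" "dim_col (toeplitz n y) = n" for y
    by (auto simp: hankel_def toeplitz_def)
  {
    assume M: "?M \<in> psd_rank_le (2 * n) K"
    define \<tau> where "\<tau> i = (if i < n then i + n else i - n)" for i
    have "\<exists>R :: nat \<Rightarrow> nat \<Rightarrow> complex.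
      (\<forall>i<2 * n. \<forall>k<K. R (\<tau> i) k = cnj (R i k)) \<and>
      (\<forall>i<2 * n. \<forall>j<2 * n. ?M $$ (i, j) = (\<Sum>k<K. R i k * cnj (R j k)))"
    proof (rule psd_conj_fixed_factorization)
      fix i j assume "i < 2 * n" "j < 2 * n"
      \<comment> \<open>The swap exchanges the two diagonal blocks and the two off-diagonal ones,
        and each pair is conjugate.\<close>
      then show "?M $$ (\<tau> i, \<tau> j) = cnj (?M $$ (i, j))"
        by (auto simp: \<tau>_def conj)
    qed (use M in \<open>auto simp: psd_rank_le_def \<tau>_def\<close>)
    then obtain R :: "nat \<Rightarrow> nat \<Rightarrow> complex" where
      Rfix: "\<And>i k. i < 2 * n \<Longrightarrow> k < K \<Longrightarrow> R (\<tau> i) k = cnj (R i k)" and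
      R: "\<And>i j. i < 2 * n \<Longrightarrow> j < 2 * n \<Longrightarrow> ?M $$ (i, j) = (\<Sum>k<K. R i k * cnj (R j k))"
      by blast
    define Z where "Z = mat n K (\<lambda>(i, k). R (i + n) k)"
    have Z: "Z \<in> carrier_mat n K" by (simp add: Z_def)
    have upper: "cnj (R j k) = R (j + n) k" if "j < n" "k < K" for j k
      using Rfix[of j k] that by (simp add: \<tau>_def)
    have "hankel n x = Z * Z\<^sup>T"
    proof (rule eq_matI)
      fix i j assume "i < dim_row (Z * Z\<^sup>T)" "j < dim_col (Z * Z\<^sup>T)"
      then have ij: "i < n" "j < n" using Z by auto
      then show "hankel n x $$ (i, j) = (Z * Z\<^sup>T) $$ (i, j)"
        \<comment> \<open>The lower left block pairs a lower row with an upper one; conjugating the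
          latter gives a row of \<open>Z\<close>, hence a transpose and not an adjoint.\<close>
        using R[of "i + n" j] upper
        by (simp add: Z_def scalar_prod_def atLeast0LessThan)
    qed (use Z in auto)
    moreover have "toeplitz n t = Z * mat_adjoint Z"
    proof (rule eq_matI)
      fix i j assume "i < dim_row (Z * mat_adjoint Z)" "j < dim_col (Z * mat_adjoint Z)"
      then have ij: "i < n" "j < n" using Z by auto
      then show "toeplitz n t $$ (i, j) = (Z * mat_adjoint Z) $$ (i, j)"
        using R[of "i + n" "j + n"]
        by (simp add: Z_def scalar_prod_def atLeast0LessThan)
    qed (use Z in auto)
    ultimately show "\<exists>Z \<in> carrier_mat n K. hankel n x = Z * Z\<^sup>T \<and> toeplitz n t = Z * mat_adjoint Z"
      using Z by blast
  next
    assume "\<exists>Z \<in> carrier_mat n K. hankel n x = Z * Z\<^sup>T \<and> toeplitz n t = Z * mat_adjoint Z"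
    then obtain Z where Z: "Z \<in> carrier_mat n K"
      and H: "hankel n x = Z * Z\<^sup>T" and T: "toeplitz n t = Z * mat_adjoint Z" by blast
    \<comment> \<open>The conjugate of \<open>Z\<close> stacked on \<open>Z\<close>: the four blocks
      of \<open>W * mat_adjoint W\<close> are then the two given products and their
      conjugates.\<close>
    define W where "W = mat (2 * n) K (\<lambda>(i, k). if i < n then cnj (Z $$ (i, k)) else Z $$ (i - n, k))"
    have W: "W \<in> carrier_mat (2 * n) K" by (simp add: W_def)
    have h: "hankel n x $$ (i, j) = (\<Sum>k<K. Z $$ (i, k) * Z $$ (j, k))"
      and tt: "toeplitz n t $$ (i, j) = (\<Sum>k<K. Z $$ (i, k) * cnj (Z $$ (j, k)))"
      if "i < n" "j < n" for i j
      using Z that by (simp_all add: H T scalar_prod_def atLeast0LessThan)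
    have "?M = W * mat_adjoint W"
    proof (rule eq_matI)
      fix i j assume "i < dim_row (W * mat_adjoint W)" "j < dim_col (W * mat_adjoint W)"
      then have ij: "i < 2 * n" "j < 2 * n" using W by auto
      then show "?M $$ (i, j) = (W * mat_adjoint W) $$ (i, j)"
        by (auto simp: W_def scalar_prod_def atLeast0LessThan conj h tt)
    qed (use W in auto)
    moreover have "vec_space.rank (2 * n) (W * mat_adjoint W) \<le> K"
      using W by (intro vec_space.rank_mult_le[of _ _ _ _ "2 * n"]) auto
    ultimately show "?M \<in> psd_rank_le (2 * n) K"
      using psd_mat_mult_adjoint[OF W] by (simp add: psd_rank_le_def)
  }
qed

theorem theorem2:
  fixes n K L :: nat
  assumes "0 < n" "0 < K" "0 < L" "K < n"
  shows "S_MF n K L = S_HT n K L"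
proof -
  have "(\<exists>Z :: nat \<Rightarrow> complex mat. \<forall>l < L. Z l \<in> carrier_mat n K \<and>
          hankel n (col X l) = Z l * (Z l)\<^sup>T \<and> toeplitz n t = Z l * mat_adjoint (Z l)) \<longleftrightarrow>
        (\<forall>l < L. four_block_mat (toeplitz n (conjugate t)) (hankel n (conjugate (col X l)))
          (hankel n (col X l)) (toeplitz n t) \<in> psd_rank_le (2 * n) K)"
    if X: "X \<in> carrier_mat (2 * n - 1) L" and t: "t \<in> carrier_vec (2 * n - 1)" for X t
  proof -
    let ?P = "\<lambda>l Z. Z \<in> carrier_mat n K \<and>
      hankel n (col X l) = Z * Z\<^sup>T \<and> toeplitz n t = Z * mat_adjoint Z"
    \<comment> \<open>Only \<open>t\<close> is shared between the columns; the factors are chosen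
      independently for each \<open>l\<close>.\<close>
    have "(\<exists>Z. \<forall>l < L. ?P l (Z l)) \<longleftrightarrow> (\<forall>l < L. \<exists>Z. ?P l Z)" by metis
    moreover have "col X l \<in> carrier_vec (2 * n - 1)" if "l < L" for l using X that by auto
    ultimately show ?thesis using hankel_toeplitz_factorization_iff[OF _ t] by (simp add: Bex_def)
  qed
  then show ?thesis unfolding S_MF_def S_HT_def by blast
qed

end
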